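(* Let $\Sigma$ be a finite alphabet. For every right-infinite word $w\in\Sigma^{\infty}$ and every integer $n\geq 1$, \[ |T_w(n)|\ \geq\ P_w(n), \] where $P_w(n)$ is the number of nonempty palindromic prefixes of $w[1,n]$ and \[ T_w(n)=\{\,w[1,j] : 1\leq j\leq n,\ \mathrm{PL}(w[1,j])=\mathrm{maxPrfPL}(w[1,j])\,\}. \] In particular, if $w$ has infinitely many nonempty palindromic prefixes, then \[ \liminf_{n\to\infty}\frac{|T_w(n)|}{P_w(n)}\geq 1 . \]
   Context: Words are over a finite alphabet $\Sigma$; $\Sigma^+$ is the set of nonempty finite words and $\Sigma^\infty$ the set of right-infinite words, with positions indexed from $1$. $w[a,b]$ denotes the factor of $w$ at positions $a,a+1,\dots,b$. A finite word is a palindrome if it equals its reversal. For $u\in\Sigma^+$, the palindromic length $\mathrm{PL}(u)$ is the least $k\geq1$ such that $u$ is a concatenation of $k$ nonempty palindromes. For $u\in\Sigma^+$, $\mathrm{maxPrfPL}(u)=\max\{\mathrm{PL}(v): v \text{ a nonempty prefix of } u\}$ (the prefix $u$ itself is included). *)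

theory Defs
  imports
    Complex_Main
    "HOL-Library.Stream"
    "HOL-Library.Sublist"
    "HOL-Library.Extended_Real"
begin

(* A right-infinite word w is a stream; w[1,j] is stake j w. *)

definition palindrome :: "'a list \<Rightarrow> bool" where
  "palindrome u \<longleftrightarrow> rev u = u"

definition PL :: "'a list \<Rightarrow> nat" where
  "PL u = (LEAST k. k \<ge> 1 \<and>
     (\<exists>ps. length ps = k \<and> (\<forall>p\<in>set ps. p \<noteq> [] \<and> palindrome p) \<and> concat ps = u))"

(* PL and maxPrfPL are meaningful only for nonempty words: on the empty word
   they are a LEAST over an unsatisfiable predicate and a Max of the empty set. *)
definition maxPrfPL :: "'a list \<Rightarrow> nat" where
  "maxPrfPL u = Max {PL v | v. v \<noteq> [] \<and> prefix v u}"

definition pal_prefix_count :: "'a stream \<Rightarrow> nat \<Rightarrow> nat" where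
  "pal_prefix_count w n = card {u. u \<noteq> [] \<and> palindrome u \<and> prefix u (stake n w)}"

definition T :: "'a stream \<Rightarrow> nat \<Rightarrow> 'a list set" where
  "T w n = {stake j w | j. 1 \<le> j \<and> j \<le> n \<and> PL (stake j w) = maxPrfPL (stake j w)}"

end

theory Submission
  imports Defs
begin

text \<open>
  The combinatorial core is an overlap inequality: if a palindromic prefix and a palindromic suffix
  of a word \<open>V\<close> overlap in \<open>\<zeta>\<close>, then \<open>PL \<zeta> \<le> PL V\<close>. It is proved by induction on the length of
  \<open>V\<close>, using that \<open>PL x \<le> PL (x @ y) + PL y\<close>. Applied to two palindromic prefixes of \<open>w\<close> of
  lengths \<open>a < b\<close>, it shows that \<open>PL w[1,j] \<le> PL w[1,j+b-a]\<close> for \<open>j \<le> a\<close>. Hence the last position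
  in \<open>[1,b]\<close> at which \<open>PL w[1,j]\<close> is maximal lies in \<open>(a,b]\<close>; it is counted by \<open>T\<close>, and different
  palindromic prefixes yield different such positions.
\<close>

section \<open>Products of palindromes and their relation to \<open>PL\<close>\<close>

lemma append_eq_append_le:
  assumes "a @ b = c @ d" "length a \<le> length c"
  shows "\<exists>e. c = a @ e \<and> b = e @ d"
  using assms by (auto simp: append_eq_append_conv2)

text \<open>Empty factors are allowed, which makes \<open>pal_product\<close> monotone in the number of factors.\<close>
definition pal_product :: "nat \<Rightarrow> 'a list \<Rightarrow> bool" where
  "pal_product k w \<longleftrightarrow> (\<exists>ps. length ps = k \<and> (\<forall>p\<in>set ps. palindrome p) \<and> concat ps = w)"

lemma pal_product_Nil [simp]: "pal_product k []"
  unfolding pal_product_def palindrome_def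
  by (rule exI[of _ "replicate k []"]) auto

lemma pal_product_append:
  assumes "pal_product k u" "pal_product m v"
  shows "pal_product (k + m) (u @ v)"
proof -
  obtain ps qs where "length ps = k" "\<forall>p\<in>set ps. palindrome p" "concat ps = u"
    "length qs = m" "\<forall>p\<in>set qs. palindrome p" "concat qs = v"
    using assms unfolding pal_product_def by blast
  then show ?thesis unfolding pal_product_def
    by (intro exI[of _ "ps @ qs"]) auto
qed

lemma pal_product_mono:
  assumes "pal_product k w" "k \<le> m"
  shows "pal_product m w"
  using pal_product_append[OF assms(1) pal_product_Nil[of "m - k"]] assms(2) by simp

lemma pal_product_one: "palindrome w \<Longrightarrow> pal_product (Suc 0) w"
  unfolding pal_product_def by (rule exI[of _ "[w]"]) auto

lemma pal_product_Cons: "palindrome q \<Longrightarrow> pal_product k w \<Longrightarrow> pal_product (Suc k) (q @ w)"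
  using pal_product_append[OF pal_product_one] by fastforce

lemma pal_product_snoc: "palindrome q \<Longrightarrow> pal_product k w \<Longrightarrow> pal_product (Suc k) (w @ q)"
  using pal_product_append[OF _ pal_product_one] by fastforce

lemma pal_product_rev_imp: "pal_product k w \<Longrightarrow> pal_product k (rev w)"
proof -
  assume "pal_product k w"
  then obtain ps where "length ps = k" "\<forall>p\<in>set ps. palindrome p" "concat ps = w"
    unfolding pal_product_def by blast
  moreover from this have "map rev ps = ps"
    by (simp add: palindrome_def map_idI)
  ultimately show ?thesis unfolding pal_product_def
    by (intro exI[of _ "rev ps"]) (auto simp: rev_concat rev_map[symmetric])
qed

lemma pal_product_rev [simp]: "pal_product k (rev w) \<longleftrightarrow> pal_product k w"
  using pal_product_rev_imp[of k w] pal_product_rev_imp[of k "rev w"] by auto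

lemma pal_product_nonempty:
  assumes "pal_product k w"
  shows "\<exists>ps. length ps \<le> k \<and> (\<forall>p\<in>set ps. p \<noteq> [] \<and> palindrome p) \<and> concat ps = w"
proof -
  obtain ps where "length ps = k" "\<forall>p\<in>set ps. palindrome p" "concat ps = w"
    using assms unfolding pal_product_def by blast
  moreover have "concat (filter (\<lambda>p. p \<noteq> []) ps) = concat ps" for ps :: "'a list list"
    by (induction ps) auto
  ultimately show ?thesis
    by (intro exI[of _ "filter (\<lambda>p. p \<noteq> []) ps"]) auto
qed

text \<open>Discarding empty factors only lowers the number of factors, and the splitting into
  single letters shows that the \<open>LEAST\<close> in \<open>PL\<close> is attained. Everything
  about \<open>PL\<close> is henceforth argued through \<open>pal_product\<close>.\<close>

lemma PL_le_iff:
  assumes "w \<noteq> []"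
  shows "PL w \<le> k \<longleftrightarrow> pal_product k w"
proof -
  let ?Q = "\<lambda>k. k \<ge> 1 \<and> (\<exists>ps. length ps = k \<and> (\<forall>p\<in>set ps. p \<noteq> [] \<and> palindrome p) \<and> concat ps = w)"
  have ex: "\<exists>k'\<le>k. ?Q k'" if P: "pal_product k w" for k
  proof -
    obtain ps where ps: "length ps \<le> k" "\<forall>p\<in>set ps. p \<noteq> [] \<and> palindrome p" "concat ps = w"
      using pal_product_nonempty[OF P] by blast
    moreover have "length ps \<ge> 1" using ps(3) assms by (cases ps) auto
    ultimately show ?thesis by (intro exI[of _ "length ps"]) auto
  qed
  have "pal_product (length w) w" unfolding pal_product_def
    by (rule exI[of _ "map (\<lambda>x. [x]) w"]) (auto simp: palindrome_def)
  then obtain n where "?Q n" using ex by blast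
  then have "?Q (PL w)" unfolding PL_def by (rule LeastI)
  then have "pal_product (PL w) w" unfolding pal_product_def by blast
  moreover have "PL w \<le> k" if P: "pal_product k w"
  proof -
    obtain k' where k': "k' \<le> k" "?Q k'" using ex[OF P] by blast
    from k'(2) have "PL w \<le> k'" unfolding PL_def by (rule Least_le)
    then show ?thesis using k'(1) by simp
  qed
  ultimately show ?thesis using pal_product_mono by blast
qed

section \<open>Cancelling a factor of a palindromic product\<close>

text \<open>Euclidean descent: both palindromes together give \<open>v @ y = y @ rev v\<close>. If
  \<open>y\<close> is no longer than \<open>v\<close>, then \<open>v = y @ w\<close> with
  \<open>w\<close> a palindrome. Otherwise \<open>y = v @ y1\<close> with \<open>y1\<close> a
  palindrome, and \<open>y1\<close> takes the role of \<open>y\<close>.\<close>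

lemma palindrome_border:
  assumes "palindrome (v @ y)" "palindrome y"
  shows "\<exists>a b. v = a @ b \<and> palindrome a \<and> palindrome b"
  using assms
proof (induction "length y" arbitrary: y rule: less_induct)
  case less
  have eq: "v @ y = y @ rev v" using less.prems unfolding palindrome_def by simp
  consider "v = []" | "length y \<le> length v" | "v \<noteq> []" "length v \<le> length y" by linarith
  then show ?case
  proof cases
    case 1
    then show ?thesis by (auto simp: palindrome_def)
  next
    case 2
    then obtain w where w: "v = y @ w"
      using append_eq_append_le[OF eq[symmetric]] by blast
    then have "palindrome w" using less.prems unfolding palindrome_def by simp
    then show ?thesis using less.prems(2) w by blast
  next
    case 3
    then obtain y1 where y1: "y = v @ y1"
      using append_eq_append_le[OF eq] by blast
    then have "y = y1 @ rev v" using eq by simp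
    moreover have "y = rev y1 @ rev v" using less.prems(2) y1 unfolding palindrome_def by simp
    ultimately have "palindrome y1" unfolding palindrome_def by simp
    then show ?thesis
      using less.hyps[of y1] y1 3 less.prems(2) by auto
  qed
qed

lemma pal_product_palindrome_border:
  assumes "palindrome (v @ y)" "palindrome y"
  shows "pal_product 2 v"
proof -
  obtain a b where "v = a @ b" "palindrome a" "palindrome b"
    using palindrome_border[OF assms] by blast
  then show ?thesis using pal_product_Cons[of a "Suc 0" b] pal_product_one[of b]
    by (simp add: numeral_2_eq_2)
qed

text \<open>Compare \<open>y\<close> with the last factor \<open>p\<close>. If
  \<open>p = v @ y\<close>, two palindromes for \<open>v\<close> replace \<open>p\<close>. If
  \<open>y = v @ p\<close> with \<open>v = a @ b\<close>, then dropping \<open>p\<close> saves one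
  factor, while cancelling \<open>b\<close> and then \<open>a\<close> costs one each.\<close>

lemma pal_product_cancel_palindrome:
  assumes "pal_product k (x @ y)" "palindrome y"
  shows "pal_product (Suc k) x"
  using assms
proof (induction "length (x @ y) + k" arbitrary: k x y rule: less_induct)
  case less
  obtain ps where ps: "length ps = k" "\<forall>p\<in>set ps. palindrome p" "concat ps = x @ y"
    using less.prems(1) unfolding pal_product_def by blast
  show ?case
  proof (cases ps rule: rev_cases)
    case Nil
    then show ?thesis using ps by simp
  next
    case (snoc qs p)
    then obtain m where m: "k = Suc m" "length qs = m" using ps by auto
    have pal: "palindrome p" and cat: "concat qs @ p = x @ y" and prod: "pal_product m (concat qs)"
      using ps snoc m by (auto simp: pal_product_def)
    from cat consider v where "p = v @ y" "x = concat qs @ v"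
      | v where "y = v @ p" "concat qs = x @ v"
      by (auto simp: append_eq_append_conv2)
    then show ?thesis
    proof cases
      case 1
      then have "pal_product 2 v" using pal_product_palindrome_border pal less.prems(2) by blast
      then show ?thesis using pal_product_append[OF prod] 1 m by fastforce
    next
      case 2
      obtain a b where ab: "v = a @ b" "palindrome a" "palindrome b"
        using palindrome_border less.prems(2) pal 2 by metis
      show ?thesis
      \<comment> \<open>An empty \<open>p\<close> does not shorten the word; only \<open>k\<close>
        decreases, hence its place in the induction measure.\<close>
      proof (cases "p = []")
        case True
        then have "pal_product m (x @ y)" using 2 prod by simp
        then show ?thesis using less.hyps[of x y m] less.prems(2) m pal_product_mono by fastforce
      next
        case False
        have "pal_product m ((x @ a) @ b)" using prod 2 ab by simp
        then have "pal_product k (x @ a)" using less.hyps[of "x @ a" b m] ab m 2 by simp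
        then show ?thesis using less.hyps[of x a k] ab 2 False by simp
      qed
    qed
  qed
qed

lemma pal_product_cancel_right:
  assumes "pal_product k (x @ y)" "pal_product m y"
  shows "pal_product (k + m) x"
proof -
  have "pal_product (k + length ps) x"
    if "\<forall>p\<in>set ps. palindrome p" "pal_product k (x @ concat ps)" for ps k
    using that
  proof (induction ps arbitrary: k rule: rev_induct)
    case (snoc p ps)
    have "pal_product (Suc k) (x @ concat ps)"
      using pal_product_cancel_palindrome[of k "x @ concat ps" p] snoc.prems by auto
    then show ?case using snoc.IH[of "Suc k"] snoc.prems by simp
  qed simp
  then show ?thesis using assms unfolding pal_product_def[of m] by blast
qed

lemma pal_product_cancel_left:
  assumes "pal_product k (y @ x)" "pal_product m y"
  shows "pal_product (k + m) x"
  using pal_product_cancel_right[of k "rev x" "rev y" m] assms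
  by (metis pal_product_rev rev_append)

section \<open>The overlap inequality\<close>

text \<open>
  The induction hypothesis of \<open>pal_product_overlap\<close> below. Of \<open>V\<close>, only the length matters.
\<close>
definition overlap_below :: "'a list \<Rightarrow> bool" where
  "overlap_below V \<longleftrightarrow> (\<forall>\<alpha> \<zeta> \<beta> k. length (\<alpha> @ \<zeta> @ \<beta>) < length V \<longrightarrow>
     palindrome (\<alpha> @ \<zeta>) \<longrightarrow> palindrome (\<zeta> @ \<beta>) \<longrightarrow>
     pal_product k (\<alpha> @ \<zeta> @ \<beta> :: 'a list) \<longrightarrow> pal_product k \<zeta>)"

lemma overlap_belowD:
  fixes V \<zeta> :: "'a list"
  assumes "overlap_below V" "length (\<alpha> @ \<zeta> @ \<beta>) < length V"
    "palindrome (\<alpha> @ \<zeta>)" "palindrome (\<zeta> @ \<beta>)" "pal_product k (\<alpha> @ \<zeta> @ \<beta>)"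
  shows "pal_product k \<zeta>"
  using assms unfolding overlap_below_def by blast

text \<open>Only \<open>\<zeta> @ v\<close> has to be shorter than \<open>V\<close>; \<alpha> may be
  of any length. The two palindromes give \<open>\<alpha> @ \<zeta> @ v\<close> the period
  \<open>length v\<close>, so a long \<alpha> can be shortened by \<open>rev v\<close>. Once
  \<alpha> is no longer than \<open>v\<close>, the word \<open>\<zeta> @ v\<close> itself is an
  overlap of two palindromes.\<close>

lemma period_shift_step:
  fixes V \<zeta> :: "'a list"
  assumes "overlap_below V" "length (\<zeta> @ v) < length V"
    and "palindrome (\<alpha> @ \<zeta>)" "palindrome (\<alpha> @ \<zeta> @ v)" "pal_product k (\<zeta> @ v)"
  shows "pal_product k \<zeta>"
  using assms
proof (induction "length \<alpha>" arbitrary: \<alpha> rule: less_induct)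
  case less
  have "\<alpha> @ \<zeta> @ v = rev v @ rev (\<alpha> @ \<zeta>)" "rev (\<alpha> @ \<zeta>) = \<alpha> @ \<zeta>"
    using less.prems(3,4) unfolding palindrome_def by simp_all
  then have eq: "\<alpha> @ \<zeta> @ v = rev v @ \<alpha> @ \<zeta>" by argo
  consider "v = []" | "length (rev v) \<ge> length \<alpha>" | "v \<noteq> []" "length (rev v) \<le> length \<alpha>"
    by linarith
  then show ?case
  proof cases
    case 1
    then show ?thesis using less.prems(5) by simp
  next
    case 2
    then obtain w where "rev v = \<alpha> @ w" using append_eq_append_le[OF eq] by blast
    then have v: "v = rev w @ rev \<alpha>" by (metis rev_append rev_rev_ident)
    have 1: "\<alpha> @ \<zeta> = rev \<zeta> @ rev \<alpha>" using less.prems(3) unfolding palindrome_def by simp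
    have "\<zeta> @ rev w @ rev \<alpha> = w @ \<alpha> @ \<zeta>" using eq v by simp
    then have 2: "\<zeta> @ rev w = w @ rev \<zeta>" using 1 by simp
    \<comment> \<open>The palindromes \<open>w @ rev \<zeta>\<close> and
      \<open>rev \<zeta> @ rev \<alpha>\<close> overlap in \<open>rev \<zeta>\<close> and together
      span \<open>\<zeta> @ v\<close>.\<close>
    have "pal_product k (rev \<zeta>)"
    proof (rule overlap_belowD[OF less.prems(1)])
      have "\<zeta> @ v = w @ rev \<zeta> @ rev \<alpha>" using 2 v by simp
      then show "length (w @ rev \<zeta> @ rev \<alpha>) < length V" "pal_product k (w @ rev \<zeta> @ rev \<alpha>)"
        using less.prems(2,5) by auto
      show "palindrome (w @ rev \<zeta>)" using 2 unfolding palindrome_def by simp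
      show "palindrome (rev \<zeta> @ rev \<alpha>)" using 1 less.prems(3) by simp
    qed
    then show ?thesis by simp
  next
    case 3
    then obtain \<alpha>1 where \<alpha>1: "\<alpha> = rev v @ \<alpha>1" using append_eq_append_le[OF eq[symmetric]] by blast
    have 1: "\<alpha>1 @ \<zeta> @ v = rev v @ \<alpha>1 @ \<zeta>" using eq \<alpha>1 by simp
    then have 2: "palindrome (\<alpha>1 @ \<zeta> @ v)" using less.prems(3) \<alpha>1 by simp
    have "\<alpha>1 @ \<zeta> @ v = rev v @ rev (\<alpha>1 @ \<zeta>)" using 2 unfolding palindrome_def by simp
    then have "palindrome (\<alpha>1 @ \<zeta>)" using 1 unfolding palindrome_def by simp
    then show ?thesis
      using less.hyps[OF _ less.prems(1,2) _ 2 less.prems(5)] \<alpha>1 3 by simp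
  qed
qed

text \<open>
  In the second alternative no direct reduction to a shorter word is possible. If it holds for the
  first as well as for the last factor, then \<open>\<alpha> @ \<zeta> = q @ m1 @ q\<close> and \<open>\<zeta> @ \<beta> = Q @ m2 @ Q\<close>, so
  that the palindromes \<open>m1\<close> and \<open>m2\<close> can be cancelled from the product of the remaining factors,
  at the price of the two factors \<open>q\<close> and \<open>Q\<close> which that product lacks.
\<close>
lemma overlap_first_factor:
  assumes below: "overlap_below (\<alpha> @ \<zeta> @ \<beta>)"
    and pal: "palindrome (\<alpha> @ \<zeta>)" "palindrome (\<zeta> @ \<beta>)"
    and V: "\<alpha> @ \<zeta> @ \<beta> = q @ w" and q: "palindrome q" "q \<noteq> []" and w: "pal_product m w"
  shows "pal_product (Suc m) \<zeta> \<or> length \<zeta> < length q \<and> 2 * length q < length (\<alpha> @ \<zeta>)"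
proof -
  have V': "(\<alpha> @ \<zeta>) @ \<beta> = q @ w" using V by simp
  \<comment> \<open>Either \<open>q\<close> covers all of \<open>\<alpha> @ \<zeta>\<close>, or it
    ends strictly inside.\<close>
  consider v where "q = \<alpha> @ \<zeta> @ v" "\<beta> = v @ w" | s where "\<alpha> @ \<zeta> = q @ s" "w = s @ \<beta>" "s \<noteq> []"
  proof (cases "length (\<alpha> @ \<zeta>) \<le> length q")
    case True
    then obtain v where "q = (\<alpha> @ \<zeta>) @ v" "\<beta> = v @ w"
      using append_eq_append_le[OF V'] by blast
    then show thesis using that(1) by simp
  next
    case False
    then obtain s where s: "\<alpha> @ \<zeta> = q @ s" "w = s @ \<beta>"
      using append_eq_append_le[OF V'[symmetric]] by fastforce
    moreover have "s \<noteq> []" using s(1) False by auto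
    ultimately show thesis using that(2) by blast
  qed
  then show ?thesis
  proof cases
    case 1
    \<comment> \<open>\<open>\<zeta> @ v @ w\<close> is the single palindrome
      \<open>\<zeta> @ \<beta>\<close>, from which the \<open>m\<close> factors of \<open>w\<close>
      are cancelled.\<close>
    have "pal_product (Suc m) (\<zeta> @ v)"
      using pal_product_cancel_right[of "Suc 0" "\<zeta> @ v" w m] pal_product_one[OF pal(2)] 1 w by simp
    moreover have "pal_product (Suc m) \<zeta>" if "\<alpha> = []"
      using that pal(1) pal_product_one pal_product_mono[of "Suc 0"] by fastforce
    ultimately show ?thesis
      using period_shift_step[OF below, of \<zeta> v \<alpha> "Suc m"] pal(1) q 1 by fastforce
  next
    case 2
    have x: "\<alpha> @ \<zeta> = rev s @ q"
      using 2(1) pal(1) q(1) rev_append[of q s] unfolding palindrome_def by argo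
    consider "length \<zeta> \<le> length q" "length s \<le> length q"
      | "length \<zeta> < length q" "length q < length s"
      | "length q \<le> length \<zeta>" "length q \<le> length \<alpha>"
      | "length q \<le> length \<zeta>" "length \<alpha> \<le> length q"
      by linarith
    then show ?thesis
    proof cases
      \<comment> \<open>\<open>q\<close> is a prefix and a suffix of
        \<open>\<alpha> @ \<zeta>\<close>, and these occurrences overlap or touch. Removing the
        prefix \<open>rev s\<close> from the whole word turns the factor \<open>q\<close> into the
        palindrome \<open>q'\<close>, keeps the number of factors and leaves \<zeta> intact.\<close>
      case a: 1
      have len: "length \<alpha> + length \<zeta> = length s + length q" using arg_cong[OF x, of length] by simp
      obtain \<alpha>1 where \<alpha>1: "\<alpha> = rev s @ \<alpha>1" "q = \<alpha>1 @ \<zeta>"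
        using append_eq_append_le[OF x[symmetric]] a len by auto
      have "rev s @ q = q @ s" using x 2(1) by simp
      then obtain q' where q': "q = rev s @ q'"
        using append_eq_append_le[of "rev s" q q s] a(2) by auto
      have "q = q' @ s" using \<open>rev s @ q = q @ s\<close> q' by simp
      moreover have "q = rev q' @ s" using q' q(1) unfolding palindrome_def by auto
      ultimately have "palindrome q'" unfolding palindrome_def by simp
      then have "pal_product (Suc m) (q' @ w)" using pal_product_Cons w by blast
      moreover have "\<alpha>1 @ \<zeta> @ \<beta> = q' @ w" using V unfolding \<alpha>1(1) q' by simp
      ultimately have prod: "pal_product (Suc m) (\<alpha>1 @ \<zeta> @ \<beta>)" by simp
      have "palindrome (\<alpha>1 @ \<zeta>)" using q(1) \<alpha>1(2) by simp
      moreover have "length (\<alpha>1 @ \<zeta> @ \<beta>) < length (\<alpha> @ \<zeta> @ \<beta>)" using \<alpha>1(1) 2(3) by simp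
      ultimately have "pal_product (Suc m) \<zeta>"
        using overlap_belowD[OF below _ _ pal(2) prod] by blast
      then show ?thesis ..
    next
      case a: 2
      then show ?thesis using 2 by simp
    next
      \<comment> \<open>Removing \<open>q\<close> from both ends of
        \<open>\<alpha> @ \<zeta>\<close> leaves an overlap in \<open>\<zeta>1\<close> inside
        \<open>w\<close>; the saved factor \<open>q\<close> then completes \<open>\<zeta>1\<close>
        to \<zeta>.\<close>
      case a: 3
      obtain \<alpha>1 where \<alpha>1: "\<alpha> = q @ \<alpha>1" using append_eq_append_le[OF 2(1)[symmetric]] a(2) by blast
      have "length \<alpha> \<le> length (rev s)" using arg_cong[OF x, of length] a(1) by simp
      then obtain \<zeta>1 where \<zeta>1: "\<zeta> = \<zeta>1 @ q"
        using append_eq_append_le[OF x] by blast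
      have "palindrome (\<alpha>1 @ \<zeta>1)" using pal(1) q(1) \<alpha>1 \<zeta>1 unfolding palindrome_def by simp
      then have "pal_product m \<zeta>1"
        using overlap_belowD[OF below, of \<alpha>1 \<zeta>1 "q @ \<beta>" m] \<alpha>1 \<zeta>1 pal(2) V w q(2) by simp
      then show ?thesis using pal_product_snoc[OF q(1)] \<zeta>1 by blast
    next
      \<comment> \<open>Here \<open>\<alpha> @ \<zeta> = \<alpha> @ \<kappa> @ rev \<alpha>\<close>,
        and \<open>q = \<alpha> @ \<gamma>\<close> ends inside \<kappa>. The palindromes \<kappa>
        and \<open>\<zeta> @ \<beta>\<close> both begin with \<gamma>, so a period shift bounds the
        rest \<eta> of \<kappa>; then \<open>q @ \<eta>\<close> is
        \<open>rev \<zeta>\<close>.\<close>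
      case a: 4
      have rx: "\<alpha> @ \<zeta> = rev \<zeta> @ rev \<alpha>" using pal(1) unfolding palindrome_def by simp
      obtain \<kappa> where \<kappa>: "rev \<zeta> = \<alpha> @ \<kappa>"
        using append_eq_append_le[OF rx] a by auto
      then have \<zeta>: "\<zeta> = \<kappa> @ rev \<alpha>" using rx by simp
      then have pal\<kappa>: "palindrome \<kappa>" using \<kappa> unfolding palindrome_def by simp
      obtain \<gamma> where \<gamma>: "q = \<alpha> @ \<gamma>"
        using append_eq_append_le[OF 2(1)] a(2) by blast
      have "\<kappa> @ rev \<alpha> = \<gamma> @ s" using 2(1) \<gamma> \<zeta> by simp
      moreover have "length \<gamma> \<le> length \<kappa>" using \<gamma> \<zeta> a(1) by simp
      ultimately obtain \<eta> where \<eta>: "\<kappa> = \<gamma> @ \<eta>"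
        using append_eq_append_le[of \<gamma> s \<kappa> "rev \<alpha>"] by auto
      have w': "w = \<eta> @ rev \<alpha> @ \<beta>" using V unfolding \<zeta> \<gamma> \<eta> by simp
      have "pal_product m \<eta>"
      proof (rule period_shift_step[OF below])
        show "length (\<eta> @ rev \<alpha> @ \<beta>) < length (\<alpha> @ \<zeta> @ \<beta>)"
          unfolding V w'[symmetric] using q(2) by simp
        show "palindrome (\<gamma> @ \<eta>)" using pal\<kappa> \<eta> by simp
        show "palindrome (\<gamma> @ \<eta> @ rev \<alpha> @ \<beta>)" using pal(2) unfolding \<zeta> \<eta> by simp
        show "pal_product m (\<eta> @ rev \<alpha> @ \<beta>)" using w w' by simp
      qed
      then have "pal_product (Suc m) (q @ \<eta>)" by (rule pal_product_Cons[OF q(1)])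
      then have "pal_product (Suc m) (rev \<zeta>)" unfolding \<kappa> \<eta> \<gamma> by simp
      then show ?thesis by simp
    qed
  qed
qed

lemma palindrome_double_border:
  assumes "palindrome x" "palindrome q" "x = q @ s" "2 * length q < length x"
  shows "\<exists>m. x = q @ m @ q \<and> palindrome m"
proof -
  have "q @ s = rev s @ q" using assms(1-3) rev_append[of q s] unfolding palindrome_def by argo
  moreover have "length q \<le> length (rev s)" using assms(3,4) by simp
  ultimately obtain m where "rev s = q @ m"
    using append_eq_append_le by blast
  then have "x = q @ m @ q" using \<open>q @ s = rev s @ q\<close> assms(3) by simp
  then show ?thesis using assms unfolding palindrome_def by simp
qed

text \<open>Reversal exchanges \<alpha> and \<beta>, so \<open>overlap_first_factor\<close> applies
  at both ends. If neither end settles the claim, then \<open>q = \<alpha>' @ \<zeta>\<close> and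
  \<open>Q = \<zeta> @ \<beta>'\<close>, and the inner factors \<open>ms\<close> spell the shorter
  overlap \<open>\<alpha>' @ \<zeta> @ \<beta>'\<close> between \<open>m1\<close> and
  \<open>m2\<close>. Cancelling these two costs exactly the two factors \<open>q\<close> and
  \<open>Q\<close> missing from \<open>ms\<close>.\<close>

lemma pal_product_overlap:
  assumes "palindrome (\<alpha> @ \<zeta>)" "palindrome (\<zeta> @ \<beta>)" "pal_product k (\<alpha> @ \<zeta> @ \<beta>)"
  shows "pal_product k \<zeta>"
  using assms
proof (induction "length (\<alpha> @ \<zeta> @ \<beta>)" arbitrary: \<alpha> \<zeta> \<beta> k rule: less_induct)
  case less
  have below: "overlap_below V" if "length V = length (\<alpha> @ \<zeta> @ \<beta>)" for V :: "'a list"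
    unfolding overlap_below_def that using less.hyps by blast
  \<comment> \<open>Empty factors are discarded so that removing \<open>q\<close> or
    \<open>Q\<close> really shortens the word.\<close>
  obtain ps where ps: "length ps \<le> k" "\<forall>p\<in>set ps. p \<noteq> [] \<and> palindrome p"
    "concat ps = \<alpha> @ \<zeta> @ \<beta>"
    using pal_product_nonempty[OF less.prems(3)] by blast
  have len: "pal_product k \<zeta>" if "pal_product (length ps) \<zeta>"
    using pal_product_mono[OF that ps(1)] .
  show ?case
  proof (cases ps)
    case Nil
    then show ?thesis using ps by simp
  next
    case (Cons q qs)
    note qs = Cons
    have V: "\<alpha> @ \<zeta> @ \<beta> = q @ concat qs" and q: "palindrome q" "q \<noteq> []"
      and prod: "pal_product (length qs) (concat qs)"
      using qs ps by (auto simp: pal_product_def)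
    consider "pal_product k \<zeta>" | "length \<zeta> < length q" "2 * length q < length (\<alpha> @ \<zeta>)"
      using overlap_first_factor[OF below[OF refl] less.prems(1,2) V q prod] len qs by auto
    then show ?thesis
    proof cases
      case near: 2
      show ?thesis
      proof (cases qs rule: rev_cases)
        case Nil
        then have "length (\<alpha> @ \<zeta> @ \<beta>) = length q" using V by simp
        then show ?thesis using near by simp
      next
        case (snoc ms Q)
        have Q: "palindrome Q" "Q \<noteq> []" using qs snoc ps by auto
        have "pal_product (Suc (length ms)) (q @ concat ms)"
          using qs snoc ps q by (intro pal_product_Cons) (auto simp: pal_product_def)
        then have prod': "pal_product (length qs) (rev (q @ concat ms))"
          using snoc by (simp del: rev_append)
        have V': "rev \<beta> @ rev \<zeta> @ rev \<alpha> = Q @ rev (q @ concat ms)"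
          using arg_cong[OF V, of rev] snoc Q(1) by (simp add: palindrome_def)
        have pal': "palindrome (rev \<beta> @ rev \<zeta>)" "palindrome (rev \<zeta> @ rev \<alpha>)"
          using less.prems(1,2) unfolding palindrome_def rev_append[symmetric] by simp_all
        consider "pal_product k \<zeta>" | "length \<zeta> < length Q" "2 * length Q < length (\<zeta> @ \<beta>)"
          using overlap_first_factor[OF below pal' V' Q prod'] len qs by auto
        then show ?thesis
        proof cases
          case far: 2
          have 1: "q @ concat qs = (\<alpha> @ \<zeta>) @ \<beta>" using V by simp
          have "length q \<le> length (\<alpha> @ \<zeta>)" using near(2) by linarith
          then obtain s where s: "\<alpha> @ \<zeta> = q @ s"
            using append_eq_append_le[OF 1] by blast
          obtain m1 where m1: "\<alpha> @ \<zeta> = q @ m1 @ q" "palindrome m1"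
            using palindrome_double_border[OF less.prems(1) q(1) s near(2)] by blast
          have 2: "\<alpha> @ (\<zeta> @ \<beta>) = (q @ concat ms) @ Q" using V snoc by simp
          have "length \<alpha> \<le> length (q @ concat ms)"
            using arg_cong[OF 2, of length] far(2) by simp
          then obtain s' where "\<zeta> @ \<beta> = s' @ Q"
            using append_eq_append_le[OF 2] by blast
          then have "\<zeta> @ \<beta> = Q @ rev s'"
            using less.prems(2) Q(1) rev_append[of s' Q] unfolding palindrome_def by argo
          then obtain m2 where m2: "\<zeta> @ \<beta> = Q @ m2 @ Q" "palindrome m2"
            using palindrome_double_border[OF less.prems(2) Q(1) _ far(2)] by blast
          \<comment> \<open>The final \<open>q\<close> of \<open>\<alpha> @ \<zeta>\<close> is
            longer than \<zeta>, so it ends in \<zeta>; symmetrically \<open>Q\<close> begins with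
            \<zeta>.\<close>
          have 3: "(q @ m1) @ q = \<alpha> @ \<zeta>" using m1(1) by simp
          have "length (q @ m1) \<le> length \<alpha>"
            using arg_cong[OF 3, of length] near(1) by simp
          then obtain \<alpha>' where \<alpha>': "\<alpha> = (q @ m1) @ \<alpha>'" "q = \<alpha>' @ \<zeta>"
            using append_eq_append_le[OF 3] by blast
          obtain \<beta>' where \<beta>': "Q = \<zeta> @ \<beta>'" "\<beta> = \<beta>' @ m2 @ Q"
            using append_eq_append_le[OF m2(1) less_imp_le[OF far(1)]] by blast
          have "q @ m1 @ (\<alpha>' @ \<zeta> @ \<beta>') @ m2 @ Q = q @ concat ms @ Q"
            using V unfolding snoc \<alpha>'(1) \<beta>'(2) unfolding \<beta>'(1) by simp
          then have ms: "concat ms = m1 @ (\<alpha>' @ \<zeta> @ \<beta>') @ m2" by simp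
          have "pal_product (length ms) (m1 @ (\<alpha>' @ \<zeta> @ \<beta>') @ m2)"
            using ps qs snoc unfolding ms[symmetric] by (auto simp: pal_product_def)
          then have "pal_product (length ms + 1) ((\<alpha>' @ \<zeta> @ \<beta>') @ m2)"
            using pal_product_cancel_left pal_product_one[OF m1(2)] by fastforce
          then have prod2: "pal_product (length ms + 2) (\<alpha>' @ \<zeta> @ \<beta>')"
            using pal_product_cancel_palindrome[OF _ m2(2)] by fastforce
          have "pal_product (length ms + 2) \<zeta>"
          proof (rule less.hyps[OF _ _ _ prod2])
            show "length (\<alpha>' @ \<zeta> @ \<beta>') < length (\<alpha> @ \<zeta> @ \<beta>)"
              using arg_cong[OF \<alpha>'(1), of length] arg_cong[OF \<beta>'(2), of length] q(2) by simp
            show "palindrome (\<alpha>' @ \<zeta>)" "palindrome (\<zeta> @ \<beta>')"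
              using q(1) Q(1) \<alpha>'(2) \<beta>'(1) by simp_all
          qed
          then show ?thesis using len qs snoc by simp
        qed
      qed
    qed
  qed
qed

corollary pal_product_period_shift:
  assumes "palindrome (\<alpha> @ \<zeta>)" "palindrome (\<alpha> @ \<zeta> @ v)" "pal_product k (\<zeta> @ v)"
  shows "pal_product k \<zeta>"
proof (rule period_shift_step[OF _ _ assms])
  \<comment> \<open>The list serves only as a length bound; \<open>undefined\<close> is a padding
    letter that makes it one longer than \<open>\<zeta> @ v\<close>.\<close>
  show "overlap_below ((undefined # \<zeta>) @ v)"
    unfolding overlap_below_def using pal_product_overlap by blast
qed simp

section \<open>Palindromic prefixes of an infinite word\<close>

text \<open>With \<open>z\<close> the prefix of length \<open>j\<close>, reversing the longer
  palindrome shows that the prefix of length \<open>j + (b - a)\<close> is \<open>rev r @ z\<close>.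
  Its reversal \<open>rev z @ r\<close> fits the period shift, since \<open>rev t @ rev z\<close>
  and \<open>rev t @ rev z @ r\<close> are the two given palindromes.\<close>

lemma PL_stake_shift:
  assumes pal: "palindrome (stake a w)" "palindrome (stake b w)" and "a \<le> b" "1 \<le> j" "j \<le> a"
  shows "PL (stake j w) \<le> PL (stake (j + (b - a)) w)"
proof -
  define z t r where "z = stake j w" "t = stake (a - j) (sdrop j w)" "r = stake (b - a) (sdrop a w)"
  have len: "length z = j" "length r = b - a" unfolding z_t_r_def by simp_all
  have x: "stake a w = z @ t"
    unfolding z_t_r_def using assms by (metis le_add_diff_inverse stake_add)
  have y: "stake b w = stake a w @ r"
    unfolding z_t_r_def using assms by (metis le_add_diff_inverse stake_add)
  have rev_x: "rev t @ rev z = stake a w" using pal(1) x unfolding palindrome_def by simp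
  have "stake b w = rev r @ z @ t"
    using pal unfolding y palindrome_def by (simp add: x)
  moreover have "j + (b - a) \<le> b" using assms(3,5) by linarith
  then have "stake (j + (b - a)) w = take (j + (b - a)) (stake b w)"
    by (metis min.absorb1 take_stake)
  ultimately have shift: "stake (j + (b - a)) w = rev r @ z"
    using len by simp
  let ?k = "PL (stake (j + (b - a)) w)"
  have "stake (j + (b - a)) w \<noteq> []" using assms(4) by simp
  then have "pal_product ?k (stake (j + (b - a)) w)" using PL_le_iff by blast
  then have "pal_product ?k (rev (rev r @ z))" unfolding shift pal_product_rev .
  then have prod: "pal_product ?k (rev z @ r)" by simp
  have "palindrome (rev t @ rev z)" using pal(1) unfolding rev_x .
  moreover have "palindrome (rev t @ rev z @ r)"
    using pal(2) unfolding y rev_x[symmetric] by simp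
  ultimately have "pal_product ?k (rev z)" using pal_product_period_shift prod by blast
  then have "pal_product ?k z" by simp
  moreover have "z \<noteq> []" using len(1) assms(4) by auto
  ultimately have "PL z \<le> ?k" using PL_le_iff by blast
  then show ?thesis by (simp only: z_t_r_def)
qed

section \<open>From sets of prefixes to sets of positions\<close>

lemma prefix_stake_iff: "prefix v (stake n w) \<longleftrightarrow> (\<exists>i\<le>n. v = stake i w)"
proof
  assume "prefix v (stake n w)"
  then show "\<exists>i\<le>n. v = stake i w"
    by (intro exI[of _ "length v"])
      (metis length_stake min.absorb1 prefix_length_le prefix_def append_eq_conv_conj take_stake)
next
  assume "\<exists>i\<le>n. v = stake i w"
  then show "prefix v (stake n w)"
    by (metis min.absorb1 take_is_prefix take_stake)
qed

lemma PL_eq_maxPrfPL_stake_iff: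
  assumes "1 \<le> n"
  shows "PL (stake n w) = maxPrfPL (stake n w) \<longleftrightarrow> (\<forall>i\<in>{1..n}. PL (stake i w) \<le> PL (stake n w))"
proof -
  have "{PL v | v. v \<noteq> [] \<and> prefix v (stake n w)} = PL ` {v. v \<noteq> [] \<and> prefix v (stake n w)}"
    by blast
  also have "{v. v \<noteq> [] \<and> prefix v (stake n w)} = (\<lambda>i. stake i w) ` {1..n}"
    unfolding prefix_stake_iff by (auto simp: Suc_le_eq)
  finally have max: "maxPrfPL (stake n w) = Max ((\<lambda>i. PL (stake i w)) ` {1..n})"
    unfolding maxPrfPL_def by (simp add: image_image)
  show ?thesis
    unfolding max using assms by (subst eq_commute, subst Max_eq_iff) auto
qed

lemma inj_stake: "inj (\<lambda>i. stake i w)"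
  by (metis injI length_stake)

lemma pal_prefix_count_eq:
  "pal_prefix_count w n = card {l\<in>{1..n}. palindrome (stake l w)}"
proof -
  have "{u. u \<noteq> [] \<and> palindrome u \<and> prefix u (stake n w)}
      = (\<lambda>l. stake l w) ` {l\<in>{1..n}. palindrome (stake l w)}"
    unfolding prefix_stake_iff by (auto simp: Suc_le_eq)
  then show ?thesis
    unfolding pal_prefix_count_def by (simp add: card_image inj_on_subset[OF inj_stake])
qed

lemma card_T_eq:
  "card (T w n) = card {j\<in>{1..n}. \<forall>i\<in>{1..j}. PL (stake i w) \<le> PL (stake j w)}"
proof -
  have "T w n = (\<lambda>j. stake j w) ` {j\<in>{1..n}. \<forall>i\<in>{1..j}. PL (stake i w) \<le> PL (stake j w)}"
    unfolding T_def using PL_eq_maxPrfPL_stake_iff by fastforce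
  then show ?thesis by (simp add: card_image inj_on_subset[OF inj_stake])
qed

section \<open>Counting record positions of the palindromic length\<close>

lemma record_after_palindromic_prefix:
  assumes b: "1 \<le> b" "palindrome (stake b w)"
  shows "\<exists>j\<in>{1..b}. (\<forall>i\<in>{1..j}. PL (stake i w) \<le> PL (stake j w)) \<and>
    (\<forall>a<b. palindrome (stake a w) \<longrightarrow> a < j)"
proof -
  define f where "f i = PL (stake i w)" for i
  define M where "M = Max (f ` {1..b})"
  define J where "J = {j\<in>{1..b}. f j = M}"
  have le_M: "f i \<le> M" if "i \<in> {1..b}" for i
    unfolding M_def using that by simp
  have "M \<in> f ` {1..b}" unfolding M_def using b by (intro Max_in) auto
  then have "J \<noteq> {}" "finite J" unfolding J_def by auto
  then have max: "i \<le> Max J" if "i \<in> J" for i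
    using that by simp
  have "Max J \<in> J" using \<open>J \<noteq> {}\<close> \<open>finite J\<close> by simp
  then have j: "1 \<le> Max J" "Max J \<le> b" "f (Max J) = M" unfolding J_def by auto
  \<comment> \<open>If \<open>Max J\<close> were at most \<open>a\<close>, shifting it by
    \<open>b - a\<close> would give a later position, still at most \<open>b\<close>, where the
    maximum is attained.\<close>
  have "a < Max J" if a: "a < b" "palindrome (stake a w)" for a
  proof (rule ccontr)
    assume "\<not> a < Max J"
    then have "f (Max J) \<le> f (Max J + (b - a))"
      unfolding f_def using PL_stake_shift[OF a(2) b(2)] a(1) j(1) by simp
    moreover have "Max J + (b - a) \<le> b" using \<open>\<not> a < Max J\<close> a(1) by linarith
    then have "Max J + (b - a) \<in> {1..b}" using j(1) by simp
    ultimately have "f (Max J + (b - a)) = M" "Max J + (b - a) \<in> {1..b}"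
      using le_M[of "Max J + (b - a)"] j(3) by auto
    then have "Max J + (b - a) \<in> J" by (simp add: J_def)
    then show False using max a(1) by fastforce
  qed
  moreover have "f i \<le> f (Max J)" if "i \<in> {1..Max J}" for i
    using le_M[of i] that j by simp
  ultimately show ?thesis using j unfolding f_def by (intro bexI[of _ "Max J"]) auto
qed

lemma pal_prefix_count_le_card_T: "pal_prefix_count w n \<le> card (T w n)"
proof -
  let ?A = "{l\<in>{1..n}. palindrome (stake l w)}"
  let ?R = "{j\<in>{1..n}. \<forall>i\<in>{1..j}. PL (stake i w) \<le> PL (stake j w)}"
  have "\<forall>b\<in>?A. \<exists>j. j \<in> ?R \<and> j \<le> b \<and> (\<forall>a<b. palindrome (stake a w) \<longrightarrow> a < j)"
    using record_after_palindromic_prefix by fastforce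
  from bchoice[OF this] obtain g where
    g: "\<forall>b\<in>?A. g b \<in> ?R \<and> g b \<le> b \<and> (\<forall>a<b. palindrome (stake a w) \<longrightarrow> a < g b)"
    by blast
  \<comment> \<open>The chosen positions are separated by the palindromic lengths themselves:
    \<open>g a \<le> a < g b\<close>.\<close>
  have mono: "g a < g b" if a: "a \<in> ?A" and b: "b \<in> ?A" and "a < b" for a b
  proof -
    have "a < g b" using bspec[OF g b] a \<open>a < b\<close> by blast
    moreover have "g a \<le> a" using bspec[OF g a] by blast
    ultimately show ?thesis by linarith
  qed
  have "inj_on g ?A"
  proof (rule linorder_inj_onI)
    show "g a \<noteq> g b" if "a < b" "a \<in> ?A" "b \<in> ?A" for a b
      using mono[OF that(2,3,1)] by simp
  qed auto
  moreover have "g ` ?A \<subseteq> ?R" using g by blast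
  ultimately have "card ?A \<le> card ?R" by (intro card_inj_on_le[of g]) simp_all
  then show ?thesis unfolding pal_prefix_count_eq card_T_eq .
qed

theorem proposition6p2:
  fixes \<Sigma> :: "'a set" and w :: "'a stream"
  assumes "finite \<Sigma>" and "w \<in> streams \<Sigma>"
  shows "(\<forall>n\<ge>1. card (T w n) \<ge> pal_prefix_count w n) \<and>
    (infinite {u. u \<noteq> [] \<and> palindrome u \<and> (\<exists>n. u = stake n w)} \<longrightarrow>
      liminf (\<lambda>n. ereal (real (card (T w n)) / real (pal_prefix_count w n))) \<ge> 1)"
proof (intro conjI impI allI)
  show "pal_prefix_count w n \<le> card (T w n)" for n
    by (rule pal_prefix_count_le_card_T)
  \<comment> \<open>The one-letter prefix is a palindrome, so the denominator is positive from
    \<open>n = 1\<close> on. At \<open>n = 0\<close> the quotient is \<open>0 / 0\<close>, which is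
    \<open>0\<close> in HOL, so the bound is only claimed eventually.\<close>
  have "pal_prefix_count w n > 0" if "n \<ge> 1" for n
  proof -
    have "1 \<in> {l\<in>{1..n}. palindrome (stake l w)}" using that by (simp add: palindrome_def)
    then show ?thesis unfolding pal_prefix_count_eq by (subst card_gt_0_iff) auto
  qed
  then have "1 \<le> ereal (real (card (T w n)) / real (pal_prefix_count w n))" if "n \<ge> 1" for n
    using pal_prefix_count_le_card_T[of w n] that by (simp add: one_ereal_def le_divide_eq_1)
  then show "1 \<le> liminf (\<lambda>n. ereal (real (card (T w n)) / real (pal_prefix_count w n)))"
    by (intro Liminf_bounded eventually_sequentiallyI)
qed

end
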